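(* Let $0\le\alpha<1$, let $s\ge 2$ and $n\ge s+1$ be integers. Among all $\widetilde{\theta}$-digraphs $\widetilde{\theta}(k_1,\ldots,k_s,l_1)$ on $n$ vertices (with $s$ paths from $v$ to $u$), the digraph $\widetilde{\theta}(0,1,1,\ldots,1,n-s,0)$ (i.e. $k=(0,1,\ldots,1,n-s)$ with $s-2$ entries equal to $1$, and $l_1=0$) is the unique digraph attaining the maximum $A_\alpha$ spectral radius, and the digraph $\widetilde{\theta}(0,1,1,\ldots,1,n-s-1)$ (i.e. $k=(0,1,\ldots,1)$ with $s-1$ entries equal to $1$, and $l_1=n-s-1$) is the unique digraph attaining the minimum $A_\alpha$ spectral radius.
   Context: All digraphs are simple (no loops, no multiple arcs). For a digraph $G$, $A(G)$ is its adjacency matrix and $D(G)$ the diagonal matrix of outdegrees; for $\alpha\in[0,1)$, $A_\alpha(G)=\alpha D(G)+(1-\alpha)A(G)$ and $\lambda_\alpha(G)$ (the $A_\alpha$ spectral radius) is the largest modulus of an eigenvalue of $A_\alpha(G)$. For $s\ge2$ and integers $k_1,\dots,k_s\ge0$, $l_1\ge0$, the digraph $\widetilde{\theta}(k_1,\ldots,k_s,l_1)$ consists of two distinct vertices $u,v$, $s$ internally disjoint directed paths from $v$ to $u$ having $k_1,\ldots,k_s$ internal vertices respectively, and one directed path from $u$ to $v$ with $l_1$ internal vertices, internally disjoint from the others; it has $n=\sum_i k_i+l_1+2$ vertices and contains exactly $s$ directed cycles. Simplicity requires at most one $k_i$ to be $0$. It depends up to isomorphism only on the multiset $\{k_1,\dots,k_s\}$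 and $l_1$. These are called $\widetilde{\theta}$-digraphs. *)

theory Defs
  imports "Graph_Theory.Graph_Theory" "Jordan_Normal_Form.Spectral_Radius"
begin

text \<open>Matrices are indexed by positions in an enumeration \<open>vs\<close> of the vertex set.\<close>

definition adjacency_mat :: "'a list \<Rightarrow> ('a, 'b) pre_digraph \<Rightarrow> real mat" where
  "adjacency_mat vs G =
     mat (length vs) (length vs) (\<lambda>(i, j). if vs ! i \<rightarrow>\<^bsub>G\<^esub> vs ! j then 1 else 0)"

definition outdegree_mat :: "'a list \<Rightarrow> ('a, 'b) pre_digraph \<Rightarrow> real mat" where
  "outdegree_mat vs G =
     mat (length vs) (length vs) (\<lambda>(i, j). if i = j then real (out_degree G (vs ! i)) else 0)"

definition A_alpha :: "real \<Rightarrow> 'a list \<Rightarrow> ('a, 'b) pre_digraph \<Rightarrow> real mat" where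
  "A_alpha \<alpha> vs G = \<alpha> \<cdot>\<^sub>m outdegree_mat vs G + (1 - \<alpha>) \<cdot>\<^sub>m adjacency_mat vs G"

text \<open>
  The spectrum of \<open>A_alpha \<alpha> vs G\<close> does not depend on the enumeration (two enumerations give
  permutation-similar matrices), so an arbitrary one is chosen.
\<close>

definition vertex_enum :: "('a, 'b) pre_digraph \<Rightarrow> 'a list" where
  "vertex_enum G = (SOME vs. distinct vs \<and> set vs = verts G)"

definition lambda_alpha :: "real \<Rightarrow> ('a, 'b) pre_digraph \<Rightarrow> real" where
  "lambda_alpha \<alpha> G =
     spectral_radius (map_mat complex_of_real (A_alpha \<alpha> (vertex_enum G) G))"

text \<open>
  \<open>InnerVU i j\<close> is the \<open>j\<close>-th internal vertex of the \<open>i\<close>-th path from \<open>v\<close> to \<open>u\<close>, and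
  \<open>InnerUV j\<close> the \<open>j\<close>-th internal vertex of the path from \<open>u\<close> to \<open>v\<close> (counted from 0).
\<close>

datatype theta_vertex = VertU | VertV | InnerVU nat nat | InnerUV nat

definition path_vu :: "nat \<Rightarrow> nat \<Rightarrow> theta_vertex list" where
  "path_vu i k = VertV # map (InnerVU i) [0..<k] @ [VertU]"

definition path_uv :: "nat \<Rightarrow> theta_vertex list" where
  "path_uv l = VertU # map InnerUV [0..<l] @ [VertV]"

definition path_arcs :: "'a list \<Rightarrow> ('a \<times> 'a) set" where
  "path_arcs p = set (zip p (tl p))"

definition theta :: "nat list \<Rightarrow> nat \<Rightarrow> theta_vertex pair_pre_digraph" where
  "theta ks l =
     \<lparr> pverts = (\<Union>i<length ks. set (path_vu i (ks ! i))) \<union> set (path_uv l),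
       parcs = (\<Union>i<length ks. path_arcs (path_vu i (ks ! i))) \<union> path_arcs (path_uv l) \<rparr>"

text \<open>
  In \<open>theta ks l\<close> two paths without internal vertices would collapse to the same arc; the
  condition on \<open>count_list\<close> excludes this, as simplicity of the digraph requires.
\<close>

definition is_theta_digraph :: "nat \<Rightarrow> ('a, 'b) pre_digraph \<Rightarrow> bool" where
  "is_theta_digraph s G \<longleftrightarrow>
     (\<exists>ks l. length ks = s \<and> count_list ks 0 \<le> 1 \<and> digraph_iso G (with_proj (theta ks l)))"

lemma path_arcs_subset: "path_arcs p \<subseteq> set p \<times> set p"
  unfolding path_arcs_def by (cases p) (auto dest: set_zip_leftD set_zip_rightD)

lemma path_arcs_loopfree: "distinct p \<Longrightarrow> (x, x) \<notin> path_arcs p"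
proof
  assume d: "distinct p" and "(x, x) \<in> path_arcs p"
  then obtain i where "i < length p" "Suc i < length p" "p ! i = x" "p ! Suc i = x"
    unfolding path_arcs_def by (fastforce simp: in_set_zip nth_tl)
  with d show False by (metis n_not_Suc_n nth_eq_iff_index_eq)
qed

lemma distinct_path_vu: "distinct (path_vu i k)"
  and distinct_path_uv: "distinct (path_uv l)"
  by (auto simp: path_vu_def path_uv_def distinct_map inj_on_def)

lemma pair_digraph_theta: "pair_digraph (theta ks l)"
proof
  show "finite (pverts (theta ks l))" "finite (parcs (theta ks l))"
    by (simp_all add: theta_def path_arcs_def)
  show "fst e \<in> pverts (theta ks l)" "snd e \<in> pverts (theta ks l)"
    if "e \<in> parcs (theta ks l)" for e
    using that path_arcs_subset by (fastforce simp: theta_def)+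
  show "fst e \<noteq> snd e" if "e \<in> parcs (theta ks l)" for e
    using that path_arcs_loopfree[OF distinct_path_vu] path_arcs_loopfree[OF distinct_path_uv]
    by (cases e) (auto simp: theta_def)
qed

lemma card_verts_theta:
  assumes "ks \<noteq> []"
  shows "card (verts (with_proj (theta ks l))) = sum_list ks + l + 2"
proof -
  let ?S = "SIGMA i:{..<length ks}. {..<ks ! i}"
  have eq: "pverts (theta ks l) = {VertU, VertV} \<union> case_prod InnerVU ` ?S \<union> InnerUV ` {..<l}"
    using assms by (auto simp: theta_def path_vu_def path_uv_def)
  have "card (case_prod InnerVU ` ?S) = sum_list ks"
    by (subst card_image)
       (auto simp: inj_on_def sum_list_sum_nth atLeast0LessThan)
  moreover have "card (InnerUV ` {..<l}) = l"
    by (subst card_image) (auto simp: inj_on_def)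
  moreover have "finite ?S" by simp
  ultimately show ?thesis
    unfolding pair_pre_digraph.select_convs with_proj_simps eq
    by (subst card_Un_disjoint, simp, simp, force, subst card_Un_disjoint) auto
qed

end

theory Submission
  imports Defs
begin

text \<open>
  Every vertex other than \<open>v\<close> has outdegree 1, so along the paths a positive eigenvector for
  \<open>\<lambda> = \<alpha> + (1 - \<alpha>) t\<close> is a geometric progression with ratio \<open>t\<close>, and the equation at \<open>v\<close>
  becomes \<open>t - \<alpha> (s - 1) / (1 - \<alpha>) = (\<Sum>i. t powr (- (k\<^sub>i + l + 1)))\<close>. A nonnegative matrix with a
  positive eigenvector has the corresponding eigenvalue as spectral radius, so \<open>\<lambda>\<close> is determined by
  the root \<open>t > 1\<close> of this equation. Its left side increases and its right side decreases in \<open>t\<close>;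
  hence a pointwise comparison of the right sides for \<open>q = 1 / t\<close> in \<open>(0, 1)\<close> orders the spectral
  radii. The maximum follows by pushing \<open>l\<close> into the longest path and from
  \<open>q + q ^ (a + b - 1) - q ^ a - q ^ b = q (1 - q ^ (a - 1)) (1 - q ^ (b - 1)) \<ge> 0\<close>, the minimum from
  bounding each cycle length by what the other paths leave over.
\<close>

section \<open>Positive eigenvectors determine the spectral radius\<close>

text \<open>For any complex eigenvector \<open>y\<close>, look at the row where the ratio of |y_i|
  to \<open>x i\<close> is largest. There the triangle inequality bounds the modulus of the
  eigenvalue by \<open>\<mu>\<close>, and \<open>x\<close> itself shows that \<open>\<mu>\<close> is
  attained. Irreducibility of the matrix does not enter.\<close>

lemma spectral_radius_eqI_positive_eigenvector:
  fixes A :: "real mat" and x :: "nat \<Rightarrow> real"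
  assumes A: "A \<in> carrier_mat n n" and n: "n > 0"
    and nonneg: "\<And>i j. i < n \<Longrightarrow> j < n \<Longrightarrow> A $$ (i, j) \<ge> 0"
    and pos: "\<And>i. i < n \<Longrightarrow> x i > 0"
    and eig: "\<And>i. i < n \<Longrightarrow> (\<Sum>j<n. A $$ (i, j) * x j) = \<mu> * x i"
  shows "spectral_radius (map_mat complex_of_real A) = \<mu>"
proof -
  let ?C = "map_mat complex_of_real A"
  have C: "?C \<in> carrier_mat n n" using A by simp
  have mult: "(?C *\<^sub>v y) $ i = (\<Sum>j<n. complex_of_real (A $$ (i, j)) * y $ j)"
    if "i < n" "y \<in> carrier_vec n" for i y
    using that A by (auto simp: scalar_prod_def atLeast0LessThan intro!: sum.cong)
  \<comment> \<open>The spectral radius is a maximum of moduli, so the eigenvalue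
    \<open>\<mu>\<close> must equal its own modulus.\<close>
  have mu: "\<mu> \<ge> 0"
  proof -
    have "0 \<le> (\<Sum>j<n. A $$ (0, j) * x j)"
      using n nonneg pos by (intro sum_nonneg mult_nonneg_nonneg) (auto simp: less_imp_le)
    with eig[OF n] pos[OF n] show ?thesis by (simp add: zero_le_mult_iff)
  qed
  have bound: "norm k \<le> \<mu>" if "k \<in> spectrum ?C" for k
  proof -
    from that obtain y where y: "y \<in> carrier_vec n" "y \<noteq> 0\<^sub>v n" "?C *\<^sub>v y = k \<cdot>\<^sub>v y"
      using A by (auto simp: spectrum_def eigenvalue_def eigenvector_def)
    define r where "r i = norm (y $ i) / x i" for i
    define m where "m = Max (r ` {..<n})"
    have fin: "finite (r ` {..<n})" "r ` {..<n} \<noteq> {}" using n by auto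
    have le: "norm (y $ i) \<le> m * x i" if "i < n" for i
    proof -
      have "r i \<le> m" unfolding m_def using that by (intro Max_ge) auto
      then show ?thesis using pos[OF that] by (simp add: r_def field_simps)
    qed
    from Max_in[OF fin] obtain i where i: "i < n" "m = r i" unfolding m_def by auto
    have ieq: "norm (y $ i) = m * x i" using i pos[of i] by (simp add: r_def)
    \<comment> \<open>A nonzero entry of \<open>y\<close> makes the maximal ratio \<open>m\<close>
      positive, so that \<open>m * x i\<close> can be cancelled at the end.\<close>
    obtain i0 where i0: "i0 < n" "y $ i0 \<noteq> 0"
      using y(1,2) by (metis carrier_vecD eq_vecI index_zero_vec)
    have "0 < m * x i0" using le[OF i0(1)] i0(2) by (metis less_le_trans zero_less_norm_iff)
    then have m: "m > 0" using pos[OF i0(1)] by (simp add: zero_less_mult_iff)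
    have "norm k * norm (y $ i) = norm ((?C *\<^sub>v y) $ i)"
      using y i by (simp add: norm_mult)
    also have "\<dots> \<le> (\<Sum>j<n. A $$ (i, j) * norm (y $ j))"
      unfolding mult[OF i(1) y(1)]
      by (rule order_trans[OF norm_sum]) (auto simp: norm_mult nonneg i intro!: sum_mono)
    also have "\<dots> \<le> (\<Sum>j<n. A $$ (i, j) * (m * x j))"
      using nonneg i le by (intro sum_mono mult_left_mono) auto
    also have "\<dots> = m * (\<Sum>j<n. A $$ (i, j) * x j)"
      by (simp add: sum_distrib_left algebra_simps)
    also have "\<dots> = \<mu> * norm (y $ i)" by (simp add: eig[OF i(1)] ieq)
    finally show ?thesis using ieq m pos[OF i(1)] by simp
  qed
  have mem: "complex_of_real \<mu> \<in> spectrum ?C"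
  proof -
    define y where "y = vec n (\<lambda>i. complex_of_real (x i))"
    have y: "y \<in> carrier_vec n" by (simp add: y_def)
    have "?C *\<^sub>v y = complex_of_real \<mu> \<cdot>\<^sub>v y"
    proof (rule eq_vecI)
      show "dim_vec (?C *\<^sub>v y) = dim_vec (complex_of_real \<mu> \<cdot>\<^sub>v y)" using A y by simp
      fix i assume "i < dim_vec (complex_of_real \<mu> \<cdot>\<^sub>v y)"
      then have i: "i < n" using y by simp
      have "(?C *\<^sub>v y) $ i = complex_of_real (\<Sum>j<n. A $$ (i, j) * x j)"
        unfolding mult[OF i y] by (simp add: y_def)
      then show "(?C *\<^sub>v y) $ i = (complex_of_real \<mu> \<cdot>\<^sub>v y) $ i"
        using i by (simp add: eig y_def)
    qed
    moreover have "y \<noteq> 0\<^sub>v n"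
    proof
      assume "y = 0\<^sub>v n"
      then have "y $ 0 = 0" using n by simp
      then show False using n pos[OF n] by (simp add: y_def)
    qed
    ultimately show ?thesis
      using A y by (auto simp: spectrum_def eigenvalue_def eigenvector_def)
  qed
  show ?thesis
  proof (rule antisym)
    show "spectral_radius ?C \<le> \<mu>"
      using spectral_radius_mem_max(1)[OF C n] bound by auto
    show "\<mu> \<le> spectral_radius ?C"
      using spectral_radius_mem_max(2)[OF C n imageI[OF mem]] mu by simp
  qed
qed

text \<open>The eigenvector is a function on vertices, so the arbitrary choice in
  \<open>vertex_enum\<close> matters only as a bijection from indices to vertices, along which the
  row sums are reindexed.\<close>

lemma lambda_alpha_eqI_positive_eigenvector:
  fixes G :: "('a, 'b) pre_digraph" and x :: "'a \<Rightarrow> real"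
  assumes fin: "finite (verts G)" and ne: "verts G \<noteq> {}"
    and \<alpha>: "0 \<le> \<alpha>" "\<alpha> \<le> 1"
    and pos: "\<And>v. v \<in> verts G \<Longrightarrow> x v > 0"
    and eig: "\<And>v. v \<in> verts G \<Longrightarrow>
      \<alpha> * real (out_degree G v) * x v + (1 - \<alpha>) * (\<Sum>w\<in>{w \<in> verts G. v \<rightarrow>\<^bsub>G\<^esub> w}. x w) = \<mu> * x v"
  shows "lambda_alpha \<alpha> G = \<mu>"
proof -
  define vs where "vs = vertex_enum G"
  have "\<exists>vs. distinct vs \<and> set vs = verts G" using finite_distinct_list[OF fin] by blast
  then have vs: "distinct vs" "set vs = verts G"
    unfolding vs_def vertex_enum_def by (metis (mono_tags, lifting) someI_ex)+
  define n where "n = length vs"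
  have bij: "bij_betw ((!) vs) {..<n} (verts G)"
    using bij_betw_nth[OF vs(1)] vs(2) by (auto simp: n_def)
  have mem: "vs ! i \<in> verts G" if "i < n" for i using that vs(2) by (auto simp: n_def)
  have entry: "A_alpha \<alpha> vs G $$ (i, j) =
      (if i = j then \<alpha> * real (out_degree G (vs ! i)) else 0) +
      (1 - \<alpha>) * (if vs ! i \<rightarrow>\<^bsub>G\<^esub> vs ! j then 1 else 0)" if "i < n" "j < n" for i j
    using that by (simp add: A_alpha_def outdegree_mat_def adjacency_mat_def n_def)
  have "spectral_radius (map_mat complex_of_real (A_alpha \<alpha> vs G)) = \<mu>"
  proof (rule spectral_radius_eqI_positive_eigenvector[where n = n and x = "\<lambda>i. x (vs ! i)"])
    show "A_alpha \<alpha> vs G \<in> carrier_mat n n"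
      by (simp add: A_alpha_def outdegree_mat_def adjacency_mat_def n_def)
    show "n > 0" using ne vs(2) by (auto simp: n_def)
    show "A_alpha \<alpha> vs G $$ (i, j) \<ge> 0" if "i < n" "j < n" for i j
      using that \<alpha> by (simp add: entry)
    show "x (vs ! i) > 0" if "i < n" for i using pos mem[OF that] by blast
    fix i assume i: "i < n"
    have "(\<Sum>j<n. A_alpha \<alpha> vs G $$ (i, j) * x (vs ! j)) =
      (\<Sum>j<n. (if j = i then \<alpha> * real (out_degree G (vs ! i)) * x (vs ! i) else 0)) +
      (1 - \<alpha>) * (\<Sum>j<n. if vs ! i \<rightarrow>\<^bsub>G\<^esub> vs ! j then x (vs ! j) else 0)"
      unfolding sum_distrib_left sum.distrib[symmetric]
      using i by (intro sum.cong) (auto simp: entry algebra_simps)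
    also have "(\<Sum>j<n. if vs ! i \<rightarrow>\<^bsub>G\<^esub> vs ! j then x (vs ! j) else 0) =
      (\<Sum>w\<in>verts G. if vs ! i \<rightarrow>\<^bsub>G\<^esub> w then x w else 0)"
      by (rule sum.reindex_bij_betw[OF bij])
    also have "\<dots> = (\<Sum>w\<in>{w \<in> verts G. vs ! i \<rightarrow>\<^bsub>G\<^esub> w}. x w)"
      using fin by (simp add: sum.inter_filter)
    finally show "(\<Sum>j<n. A_alpha \<alpha> vs G $$ (i, j) * x (vs ! j)) = \<mu> * x (vs ! i)"
      using eig[OF mem[OF i]] i by simp
  qed
  then show ?thesis by (simp add: lambda_alpha_def vs_def)
qed

text \<open>An eigenvector of \<open>H\<close> is pulled back along the isomorphism. One computation
  on the concrete digraph then serves every isomorphic \<open>G\<close>, whatever its vertex and arc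
  types.\<close>

lemma lambda_alpha_eqI_iso:
  fixes G :: "('a, 'b) pre_digraph" and H :: "('c, 'd) pre_digraph" and x :: "'c \<Rightarrow> real"
  assumes iso: "digraph_iso G H"
    and fin: "finite (verts H)" and ne: "verts H \<noteq> {}"
    and \<alpha>: "0 \<le> \<alpha>" "\<alpha> \<le> 1"
    and pos: "\<And>v. v \<in> verts H \<Longrightarrow> x v > 0"
    and eig: "\<And>v. v \<in> verts H \<Longrightarrow>
      \<alpha> * real (out_degree H v) * x v + (1 - \<alpha>) * (\<Sum>w\<in>{w \<in> verts H. v \<rightarrow>\<^bsub>H\<^esub> w}. x w) = \<mu> * x v"
  shows "lambda_alpha \<alpha> G = \<mu>"
proof -
  from iso obtain f where f: "pre_digraph.digraph_isomorphism G f" and H: "H = app_iso f G"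
    by (auto simp: digraph_iso_def)
  interpret wf_digraph G using f by (simp add: pre_digraph.digraph_isomorphism_def)
  let ?h = "iso_verts f"
  have inj: "inj_on ?h (verts G)" using f by (rule digraph_isomorphism_inj_on_verts)
  have verts: "verts H = ?h ` verts G" by (simp add: H)
  show ?thesis
  proof (rule lambda_alpha_eqI_positive_eigenvector[where x = "\<lambda>v. x (?h v)"])
    show "finite (verts G)" using fin inj by (simp add: verts finite_image_iff)
    show "verts G \<noteq> {}" using ne by (simp add: verts)
    show "0 \<le> \<alpha>" "\<alpha> \<le> 1" by fact+
    show "x (?h v) > 0" if "v \<in> verts G" for v using pos that by (simp add: verts)
    fix v assume v: "v \<in> verts G"
    have dom: "?h v \<rightarrow>\<^bsub>H\<^esub> ?h w \<longleftrightarrow> v \<rightarrow>\<^bsub>G\<^esub> w" if "w \<in> verts G" for w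
      unfolding H arcs_ends_app_iso_eq[OF f] using that v inj
      by (auto dest: inj_onD adj_in_verts intro: rev_image_eqI)
    have "{w \<in> verts H. ?h v \<rightarrow>\<^bsub>H\<^esub> w} = ?h ` {w \<in> verts G. v \<rightarrow>\<^bsub>G\<^esub> w}"
      using dom by (auto simp: verts)
    then have "(\<Sum>w\<in>{w \<in> verts H. ?h v \<rightarrow>\<^bsub>H\<^esub> w}. x w) =
        (\<Sum>w\<in>{w \<in> verts G. v \<rightarrow>\<^bsub>G\<^esub> w}. x (?h w))"
      using inj by (simp add: sum.reindex inj_on_subset)
    with eig[of "?h v"] v show "\<alpha> * real (out_degree G v) * x (?h v) +
        (1 - \<alpha>) * (\<Sum>w\<in>{w \<in> verts G. v \<rightarrow>\<^bsub>G\<^esub> w}. x (?h w)) = \<mu> * x (?h v)"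
      using out_degree_app_iso_eq[OF f v] by (simp add: verts H)
  qed
qed

section \<open>Arcs of theta digraphs and their positive eigenvector\<close>

text \<open>The index \<open>k\<close>, one past the last internal vertex, stands for the end of the
  path. Every arc then leads to the next index, and a path without internal vertices needs no
  separate case.\<close>

definition vu_vertex :: "nat \<Rightarrow> nat \<Rightarrow> nat \<Rightarrow> theta_vertex" where
  "vu_vertex i k j = (if j < k then InnerVU i j else VertU)"

definition uv_vertex :: "nat \<Rightarrow> nat \<Rightarrow> theta_vertex" where
  "uv_vertex l j = (if j < l then InnerUV j else VertV)"

lemma path_arcs_Cons_map:
  "path_arcs (a # map f [0..<k] @ [b]) =
     insert (a, if 0 < k then f 0 else b) ((\<lambda>j. (f j, if Suc j < k then f (Suc j) else b)) ` {..<k})"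
\<comment> \<open>Removing the first arc makes \<open>f 0\<close> the new start and shifts the
  indexing by one, so both \<open>a\<close> and \<open>f\<close> must vary.\<close>
proof (induction k arbitrary: a f)
  case 0
  then show ?case by (simp add: path_arcs_def)
next
  case (Suc k)
  have "path_arcs (a # map f [0..<Suc k] @ [b]) =
      insert (a, f 0) (path_arcs (f 0 # map (\<lambda>j. f (Suc j)) [0..<k] @ [b]))"
    by (simp add: path_arcs_def map_upt_Suc del: upt_Suc)
  also have "\<dots> = insert (a, f 0) (insert (f 0, if 0 < k then f (Suc 0) else b)
      ((\<lambda>j. (f (Suc j), if Suc j < k then f (Suc (Suc j)) else b)) ` {..<k}))"
    by (subst Suc.IH) simp
  finally show ?case by (simp add: lessThan_Suc_eq_insert_0 image_image)
qed

lemma path_arcs_vu_iff: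
  "(a, b) \<in> path_arcs (path_vu i k) \<longleftrightarrow>
     a = VertV \<and> b = vu_vertex i k 0 \<or> (\<exists>j<k. a = InnerVU i j \<and> b = vu_vertex i k (Suc j))"
  unfolding path_vu_def path_arcs_Cons_map vu_vertex_def by auto

lemma path_arcs_uv_iff:
  "(a, b) \<in> path_arcs (path_uv l) \<longleftrightarrow>
     a = VertU \<and> b = uv_vertex l 0 \<or> (\<exists>j<l. a = InnerUV j \<and> b = uv_vertex l (Suc j))"
  unfolding path_uv_def path_arcs_Cons_map uv_vertex_def by auto

lemma parcs_theta_iff:
  "(VertU, w) \<in> parcs (theta ks l) \<longleftrightarrow> w = uv_vertex l 0"
  "(InnerUV j, w) \<in> parcs (theta ks l) \<longleftrightarrow> j < l \<and> w = uv_vertex l (Suc j)"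
  "(VertV, w) \<in> parcs (theta ks l) \<longleftrightarrow> (\<exists>i<length ks. w = vu_vertex i (ks ! i) 0)"
  "(InnerVU i j, w) \<in> parcs (theta ks l) \<longleftrightarrow>
     i < length ks \<and> j < ks ! i \<and> w = vu_vertex i (ks ! i) (Suc j)"
  by (auto simp: theta_def path_arcs_vu_iff path_arcs_uv_iff)

lemma pverts_theta:
  assumes "v \<in> pverts (theta ks l)"
  obtains "v = VertU" | "v = VertV" | i j where "i < length ks" "j < ks ! i" "v = InnerVU i j"
    | j where "j < l" "v = InnerUV j"
  using assms by (auto simp: theta_def path_vu_def path_uv_def simp del: UN_insert UN_simps)

text \<open>Two paths can share their first vertex after \<open>VertV\<close> only if both go
  directly to \<open>VertU\<close>, which simplicity forbids. Hence \<open>VertV\<close> has one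
  successor per path.\<close>

lemma inj_on_vu_vertex_0:
  assumes "count_list ks 0 \<le> 1"
  shows "inj_on (\<lambda>i. vu_vertex i (ks ! i) 0) {..<length ks}"
proof (rule inj_onI, rule ccontr)
  fix i j assume ij: "i \<in> {..<length ks}" "j \<in> {..<length ks}" "i \<noteq> j"
    and eq: "vu_vertex i (ks ! i) 0 = vu_vertex j (ks ! j) 0"
  then have "ks ! i = 0" "ks ! j = 0" by (auto simp: vu_vertex_def split: if_splits)
  then have "{i, j} \<subseteq> {i. i < length ks \<and> ks ! i = 0}" using ij by auto
  then have "card {i, j} \<le> card {i. i < length ks \<and> ks ! i = 0}" by (intro card_mono) auto
  also have "\<dots> = count_list ks 0"
    unfolding count_list_eq_length_filter length_filter_conv_card
    by (rule arg_cong[where f = card]) auto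
  finally show False using assms ij by simp
qed

lemma lambda_alpha_theta:
  fixes G :: "('a, 'b) pre_digraph"
  assumes iso: "digraph_iso G (with_proj (theta ks l))"
    and simple: "count_list ks 0 \<le> 1" and \<alpha>: "0 \<le> \<alpha>" "\<alpha> < 1" and t: "t > 0"
    and root: "t - \<alpha> * (real (length ks) - 1) / (1 - \<alpha>) = (\<Sum>k\<leftarrow>ks. (1 / t) ^ (k + l + 1))"
  shows "lambda_alpha \<alpha> G = \<alpha> + (1 - \<alpha>) * t"
proof -
  let ?T = "theta ks l"
  let ?H = "with_proj ?T"
  interpret pair_digraph ?T by (rule pair_digraph_theta)
  \<comment> \<open>Normalised to 1 at \<open>VertU\<close>, the value grows by the factor
    \<open>t\<close> along each arc not leaving \<open>VertV\<close>. The exponents count arcs: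
    forwards from \<open>VertU\<close> on the path to \<open>VertV\<close>, and backwards from
    \<open>VertU\<close> on the other paths.\<close>
  define x where "x v = (case v of VertU \<Rightarrow> 1 | VertV \<Rightarrow> t ^ (l + 1)
    | InnerVU i j \<Rightarrow> (1 / t) ^ (ks ! i - j) | InnerUV j \<Rightarrow> t ^ (j + 1))" for v
  define N where "N v = {w. (v, w) \<in> parcs ?T}" for v
  have x_vu: "x (vu_vertex i (ks ! i) j) = (1 / t) ^ (ks ! i - j)" for i j
    by (simp add: x_def vu_vertex_def)
  have x_uv: "x (uv_vertex l j) = t ^ (j + 1)" if "j \<le> l" for j
    using that by (simp add: x_def uv_vertex_def)
  have deg: "out_degree ?H v = card (N v)" for v
  proof -
    have "out_arcs ?H v = Pair v ` N v" by (auto simp: out_arcs_def N_def)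
    then show ?thesis by (simp add: out_degree_def card_image inj_on_def)
  qed
  have nbr: "{w \<in> verts ?H. v \<rightarrow>\<^bsub>?H\<^esub> w} = N v" for v
    using in_arcsD2 by (auto simp: N_def arcs_ends_def arc_to_ends_def)
  \<comment> \<open>At a vertex of outdegree 1 the eigenvalue equation says just that the successor
    carries \<open>t\<close> times the value.\<close>
  have single: "\<alpha> * real (card (N v)) * x v + (1 - \<alpha>) * (\<Sum>w\<in>N v. x w) = (\<alpha> + (1 - \<alpha>) * t) * x v"
    if "N v = {w}" "x w = t * x v" for v w
    using that by (simp add: algebra_simps)
  show ?thesis
  proof (rule lambda_alpha_eqI_iso[OF iso, where x = x])
    show "finite (verts ?H)" by simp
    show "verts ?H \<noteq> {}" by (simp add: theta_def path_uv_def)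
    show "0 \<le> \<alpha>" "\<alpha> \<le> 1" using \<alpha> by auto
    show "x v > 0" for v using t by (simp add: x_def split: theta_vertex.split)
    fix v assume "v \<in> verts ?H"
    then have v: "v \<in> pverts ?T" by simp
    show "\<alpha> * real (out_degree ?H v) * x v + (1 - \<alpha>) * (\<Sum>w\<in>{w \<in> verts ?H. v \<rightarrow>\<^bsub>?H\<^esub> w}. x w) =
        (\<alpha> + (1 - \<alpha>) * t) * x v"
      unfolding deg nbr
    proof (cases rule: pverts_theta[OF v])
      case 1
      show "\<alpha> * real (card (N v)) * x v + (1 - \<alpha>) * (\<Sum>w\<in>N v. x w) = (\<alpha> + (1 - \<alpha>) * t) * x v"
        by (rule single[of _ "uv_vertex l 0"])
          (simp_all add: 1 N_def parcs_theta_iff x_uv, simp add: x_def)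
    next
      case (4 j)
      show "\<alpha> * real (card (N v)) * x v + (1 - \<alpha>) * (\<Sum>w\<in>N v. x w) = (\<alpha> + (1 - \<alpha>) * t) * x v"
        by (rule single[of _ "uv_vertex l (Suc j)"])
          (use 4 in \<open>simp_all add: N_def parcs_theta_iff x_uv\<close>, simp add: x_def)
    next
      case (3 i j)
      have "ks ! i - j = Suc (ks ! i - Suc j)" using 3 by simp
      then have "x (vu_vertex i (ks ! i) (Suc j)) = t * x v"
        using t by (simp add: x_vu) (simp add: x_def 3)
      then show "\<alpha> * real (card (N v)) * x v + (1 - \<alpha>) * (\<Sum>w\<in>N v. x w) = (\<alpha> + (1 - \<alpha>) * t) * x v"
        using 3 by (intro single) (simp_all add: N_def parcs_theta_iff)
    next
      case 2
      let ?s = "real (length ks)"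
      have N: "N v = (\<lambda>i. vu_vertex i (ks ! i) 0) ` {..<length ks}"
        by (auto simp: N_def 2 parcs_theta_iff)
      have card: "card (N v) = length ks"
        unfolding N using inj_on_vu_vertex_0[OF simple] by (simp add: card_image)
      have "(\<Sum>w\<in>N v. x w) = (\<Sum>i<length ks. (1 / t) ^ (ks ! i))"
        unfolding N using inj_on_vu_vertex_0[OF simple] by (simp add: sum.reindex x_vu)
      also have "\<dots> = (\<Sum>k\<leftarrow>ks. (1 / t) ^ k)"
        by (simp add: sum_list_sum_nth atLeast0LessThan)
      \<comment> \<open>Splitting off \<open>x v\<close>, which is \<open>t ^ (l + 1)\<close>, turns
        the equation at \<open>VertV\<close> into the hypothesis \<open>root\<close>.\<close>
      also have "\<dots> = (\<Sum>k\<leftarrow>ks. (1 / t) ^ (k + l + 1)) * t ^ (l + 1)"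
        unfolding sum_list_mult_const[symmetric] using t
        by (intro arg_cong[where f = sum_list] map_cong refl) (simp add: power_add field_simps)
      also have "\<dots> = (t - \<alpha> * (?s - 1) / (1 - \<alpha>)) * t ^ (l + 1)"
        by (simp only: root)
      finally have sum: "(1 - \<alpha>) * (\<Sum>w\<in>N v. x w) = ((1 - \<alpha>) * t - \<alpha> * (?s - 1)) * t ^ (l + 1)"
        using \<alpha> by (simp add: field_simps)
      have "x v = t ^ (l + 1)" by (simp add: 2 x_def)
      then show "\<alpha> * real (card (N v)) * x v + (1 - \<alpha>) * (\<Sum>w\<in>N v. x w) = (\<alpha> + (1 - \<alpha>) * t) * x v"
        unfolding sum card by (simp add: algebra_simps)
    qed
  qed
qed

text \<open>Relabelling the path index of each \<open>InnerVU\<close> vertex by the permutation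
  carries one digraph to the other. The multiset of path lengths therefore suffices for the extremal
  comparisons.\<close>

lemma digraph_iso_theta_permute:
  assumes "mset ks = mset ks'"
  shows "digraph_iso (with_proj (theta ks l)) (with_proj (theta ks' l))"
proof -
  from assms obtain p where p: "p permutes {..<length ks'}" and ks: "permute_list p ks' = ks"
    by (rule mset_eq_permutation)
  have len: "length ks = length ks'" using ks by auto
  have nth: "ks ! i = ks' ! p i" if "i < length ks'" for i
    using permute_list_nth[OF p that] ks by simp
  have inj_p: "inj p" using p by (rule permutes_inj)
  define f where "f v = (case v of InnerVU i j \<Rightarrow> InnerVU (p i) j | _ \<Rightarrow> v)" for v
  have inj: "inj f"
    using inj_p by (auto simp: inj_def f_def split: theta_vertex.splits)
  have vu: "map f (path_vu i k) = path_vu (p i) k" for i k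
    by (simp add: path_vu_def f_def)
  have uv: "map f (path_uv l) = path_uv l"
    by (simp add: path_uv_def f_def)
  have arcs_map: "map_prod f f ` path_arcs ws = path_arcs (map f ws)" for ws
    by (simp add: path_arcs_def map_tl[symmetric] zip_map_map map_prod_def)
  have reindex: "(\<Union>i<length ks. F (p i) (ks ! i)) = (\<Union>i<length ks'. F i (ks' ! i))"
    for F :: "nat \<Rightarrow> nat \<Rightarrow> 'z set"
  proof -
    have "(\<Union>i<length ks. F (p i) (ks ! i)) = (\<Union>i<length ks'. F (p i) (ks' ! p i))"
      using nth len by auto
    also have "\<dots> = (\<Union>i\<in>p ` {..<length ks'}. F i (ks' ! i))" by (simp only: image_image)
    finally show ?thesis by (simp add: permutes_image[OF p])
  qed
  have verts: "f ` pverts (theta ks l) = pverts (theta ks' l)"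
  proof -
    have "f ` pverts (theta ks l) =
        (\<Union>i<length ks. set (map f (path_vu i (ks ! i)))) \<union> set (map f (path_uv l))"
      by (simp add: theta_def image_Un image_UN)
    then show ?thesis
      unfolding vu uv using reindex[of "\<lambda>i k. set (path_vu i k)"] by (simp add: theta_def)
  qed
  have arcs: "map_prod f f ` parcs (theta ks l) = parcs (theta ks' l)"
    unfolding theta_def pair_pre_digraph.select_convs image_Un image_UN arcs_map vu uv
    using reindex[of "\<lambda>i k. path_arcs (path_vu i k)"] by simp
  interpret pair_digraph "theta ks l" by (rule pair_digraph_theta)
  let ?h = "\<lparr>iso_verts = f, iso_arcs = map_prod f f, iso_head = snd, iso_tail = fst\<rparr>"
  have "pre_digraph.digraph_isomorphism (with_proj (theta ks l)) ?h"
    unfolding pre_digraph.digraph_isomorphism_def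
    using inj map_prod_inj_on[OF inj inj] wf_digraph_axioms
    by (auto intro: inj_on_subset)
  moreover have "with_proj (theta ks' l) = app_iso ?h (with_proj (theta ks l))"
    by (simp add: app_iso_def verts arcs with_proj_def)
  ultimately show ?thesis unfolding digraph_iso_def by blast
qed

section \<open>Roots of the characteristic equation and comparison of radii\<close>

lemma ex_characteristic_root:
  fixes c :: real
  assumes c: "c \<ge> 0" and len: "length ks \<ge> 2"
  shows "\<exists>t>1. t - c = (\<Sum>k\<leftarrow>ks. (1 / t) ^ (k + l + 1))"
proof -
  define g where "g t = t - c - (\<Sum>i<length ks. (1 / t) ^ (ks ! i + l + 1))" for t :: real
  \<comment> \<open>At this point the difference of the two sides is nonnegative even when each
    power is bounded by 1. At 1 it equals \<open>1 - c - length ks\<close>, which is negative, so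
    the root lies strictly above 1.\<close>
  let ?b = "1 + c + real (length ks)"
  have "(\<Sum>i<length ks. (1 / ?b) ^ (ks ! i + l + 1)) \<le> (\<Sum>i<length ks. 1)"
    using c by (intro sum_mono power_le_one) auto
  then have "0 \<le> g ?b" by (simp add: g_def)
  moreover have g1: "g 1 < 0" using c len by (simp add: g_def)
  moreover have "continuous_on {1..?b} g"
    unfolding g_def by (intro continuous_intros) auto
  ultimately obtain t where t: "1 \<le> t" "g t = 0"
    using IVT'[of g 1 0 ?b] c by auto
  with g1 have "t > 1" by (cases "t = 1") auto
  with t(2) show ?thesis
    by (auto simp: g_def sum_list_sum_nth atLeast0LessThan intro!: exI[of _ t])
qed

lemma lambda_alpha_theta_eq:
  assumes "digraph_iso G (with_proj (theta ks l))" "digraph_iso H (with_proj (theta ks l))"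
    and "count_list ks 0 \<le> 1" "length ks \<ge> 2" "0 \<le> \<alpha>" "\<alpha> < 1"
  shows "lambda_alpha \<alpha> G = lambda_alpha \<alpha> H"
proof -
  have "0 \<le> \<alpha> * (real (length ks) - 1) / (1 - \<alpha>)" using assms by simp
  from ex_characteristic_root[OF this, of ks l] assms(4) obtain t where "t > 1"
    "t - \<alpha> * (real (length ks) - 1) / (1 - \<alpha>) = (\<Sum>k\<leftarrow>ks. (1 / t) ^ (k + l + 1))" by auto
  with assms show ?thesis by (simp add: lambda_alpha_theta[of _ ks l _ t])
qed

text \<open>Equal numbers of paths give the same constant \<open>?c\<close>. If
  \<open>t' \<le> t\<close>, then \<open>t - ?c\<close> is below the second sum at
  \<open>1 / t\<close>, hence below the one at \<open>1 / t'\<close>, which is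
  \<open>t' - ?c\<close>: a contradiction.\<close>

lemma lambda_alpha_theta_less:
  assumes isos: "digraph_iso G (with_proj (theta ks l))" "digraph_iso H (with_proj (theta ks' l'))"
    and simple: "count_list ks 0 \<le> 1" "count_list ks' 0 \<le> 1"
    and len: "length ks \<ge> 2" "length ks' = length ks" and \<alpha>: "0 \<le> \<alpha>" "\<alpha> < 1"
    and less: "\<And>q :: real. 0 < q \<Longrightarrow> q < 1 \<Longrightarrow>
      (\<Sum>k\<leftarrow>ks. q ^ (k + l + 1)) < (\<Sum>k\<leftarrow>ks'. q ^ (k + l' + 1))"
  shows "lambda_alpha \<alpha> G < lambda_alpha \<alpha> H"
proof -
  let ?c = "\<alpha> * (real (length ks) - 1) / (1 - \<alpha>)"
  have c: "0 \<le> ?c" using assms by simp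
  obtain t where t: "t > 1" "t - ?c = (\<Sum>k\<leftarrow>ks. (1 / t) ^ (k + l + 1))"
    using ex_characteristic_root[OF c, of ks l] len by auto
  obtain t' where t': "t' > 1" "t' - ?c = (\<Sum>k\<leftarrow>ks'. (1 / t') ^ (k + l' + 1))"
    using ex_characteristic_root[OF c, of ks' l'] len by auto
  have "t < t'"
  proof (rule ccontr)
    assume "\<not> t < t'"
    then have "t' \<le> t" by simp
    have "t - ?c < (\<Sum>k\<leftarrow>ks'. (1 / t) ^ (k + l' + 1))"
      unfolding t(2) using t(1) by (intro less) auto
    also have "\<dots> \<le> (\<Sum>k\<leftarrow>ks'. (1 / t') ^ (k + l' + 1))"
      using \<open>t' \<le> t\<close> t'(1) by (intro sum_list_mono power_mono) (auto simp: frac_le)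
    finally show False using t'(2) \<open>t' \<le> t\<close> by simp
  qed
  moreover have "lambda_alpha \<alpha> G = \<alpha> + (1 - \<alpha>) * t"
    using isos simple \<alpha> t by (intro lambda_alpha_theta) auto
  moreover have "lambda_alpha \<alpha> H = \<alpha> + (1 - \<alpha>) * t'"
    using isos simple \<alpha> t' len by (intro lambda_alpha_theta[of _ ks' l']) auto
  ultimately show ?thesis using \<alpha> by simp
qed

section \<open>Extremal power sums over multisets of path lengths\<close>

lemma size_le_sum_mset:
  fixes M :: "nat multiset"
  assumes "0 \<notin># M"
  shows "size M \<le> sum_mset M"
  using assms by (induction M) auto

lemma eq_replicate_mset_of_sum_mset:
  fixes M :: "nat multiset"
  assumes "0 \<notin># M" "sum_mset M = size M"
  shows "M = replicate_mset (size M) 1"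
  using assms
proof (induction M)
  case (add x M)
  then have "x \<ge> 1" "size M \<le> sum_mset M" using size_le_sum_mset[of M] by auto
  with add.prems have "x = 1" "sum_mset M = size M" by auto
  with add show ?case by auto
qed simp

text \<open>Replacing entries \<open>x\<close> and \<open>b\<close> by \<open>1\<close> and
  \<open>x + b - 1\<close> keeps size and sum and does not lower the power sum; repeating this
  collects all excess in one entry. The disjunction carries uniqueness of the maximiser through the
  induction together with the bound.\<close>

lemma sum_power_pos_multiset_le:
  fixes q :: real
  assumes "0 < q" "q < 1" "0 \<notin># M" "M \<noteq> {#}"
  shows "M = replicate_mset (size M - 1) 1 + {#sum_mset M - (size M - 1)#} \<or>
    (\<Sum>k\<in>#M. q ^ k) < real (size M - 1) * q + q ^ (sum_mset M - (size M - 1))"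
  using assms(3,4)
proof (induction M)
  case (add x M)
  show ?case
  proof (cases "M = {#}")
    case False
    \<comment> \<open>\<open>b\<close> is the large entry of the extremal multiset of the size and
      sum of \<open>M\<close>; adding \<open>x\<close> raises it to
      \<open>x + (b - 1)\<close>.\<close>
    define m b where "m = size M" and "b = sum_mset M - (size M - 1)"
    have x: "x \<ge> 1" and M: "0 \<notin># M" using add.prems by auto
    have m: "m \<ge> 1" using False by (simp add: m_def Suc_leI nonempty_has_size)
    have S: "m \<le> sum_mset M" using size_le_sum_mset[OF M] by (simp add: m_def)
    have b: "b \<ge> 1" using S m by (simp add: b_def m_def)
    have exp: "sum_mset (add_mset x M) - (size (add_mset x M) - 1) = x + (b - 1)"
      using S m by (simp add: b_def m_def)
    have id: "q + q ^ (x + (b - 1)) - (q ^ x + q ^ b) = q * (1 - q ^ (x - 1)) * (1 - q ^ (b - 1))"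
      using x b by (cases x; cases b) (auto simp: power_add algebra_simps)
    have nn: "0 \<le> q * (1 - q ^ (x - 1))" "0 \<le> 1 - q ^ (b - 1)"
      using assms(1,2) by (auto simp: power_le_one)
    have le: "q ^ x + q ^ b \<le> q + q ^ (x + (b - 1))"
      using id mult_nonneg_nonneg[OF nn] by linarith
    from add.IH[OF M False] show ?thesis
    proof
      assume "(\<Sum>k\<in>#M. q ^ k) < real (size M - 1) * q + q ^ (sum_mset M - (size M - 1))"
      then have "q ^ x + (\<Sum>k\<in>#M. q ^ k) < real m * q + q ^ (x + (b - 1))"
        using le m by (simp add: m_def b_def of_nat_diff algebra_simps)
      then show ?thesis unfolding exp by (simp add: m_def)
    next
      assume M_eq: "M = replicate_mset (size M - 1) 1 + {#sum_mset M - (size M - 1)#}"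
      then have M_eq': "M = replicate_mset (m - 1) 1 + {#b#}" by (simp only: m_def b_def)
      have rep: "replicate_mset m 1 = add_mset (1::nat) (replicate_mset (m - 1) 1)"
        using m by (cases m) auto
      show ?thesis
      \<comment> \<open>These are the cases where the product in \<open>id\<close> vanishes. The
        exchange then changes nothing, so the enlarged multiset is again extremal; otherwise the
        gain is strict.\<close>
      proof (cases "x = 1 \<or> b = 1")
        case True
        then have "add_mset x M = replicate_mset m 1 + {#x + (b - 1)#}"
          using b x unfolding rep by (subst M_eq') auto
        then show ?thesis unfolding exp by (simp add: m_def)
      next
        case False
        then have "0 < q * (1 - q ^ (x - 1)) * (1 - q ^ (b - 1))"
          using assms(1,2) x b by (intro mult_pos_pos) (auto simp: power_less_one_iff)
        then have "q ^ x + q ^ b < q + q ^ (x + (b - 1))" using id by linarith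
        moreover have "(\<Sum>k\<in>#M. q ^ k) = real (m - 1) * q + q ^ b"
          by (subst M_eq') simp
        ultimately have "q ^ x + (\<Sum>k\<in>#M. q ^ k) < real m * q + q ^ (x + (b - 1))"
          using m by (simp add: of_nat_diff algebra_simps)
        then show ?thesis unfolding exp by (simp add: m_def)
      qed
    qed
  qed simp
qed simp

text \<open>A single zero is split off and the positive case applies to the rest. Without a zero,
  the positive bound is strictly improved by trading one entry for a zero.\<close>

lemma sum_power_multiset_le:
  fixes q :: real
  assumes q: "0 < q" "q < 1" and c: "count M 0 \<le> 1" and s: "size M = s" "s \<ge> 2"
  shows "M = add_mset 0 (replicate_mset (s - 2) 1 + {#sum_mset M + 2 - s#}) \<or>
    (\<Sum>k\<in>#M. q ^ k) < 1 + real (s - 2) * q + q ^ (sum_mset M + 2 - s)"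
proof (cases "0 \<in># M")
  case True
  then obtain M' where M: "M = add_mset 0 M'" by (metis multi_member_split)
  then have "0 \<notin># M'" using c by (simp add: not_in_iff)
  moreover have "M' \<noteq> {#}" "size M' - 1 = s - 2" "sum_mset M' - (s - 2) = sum_mset M + 2 - s"
    using M s by auto
  ultimately show ?thesis using sum_power_pos_multiset_le[OF q, of M'] M by auto
next
  case False
  define e where "e = sum_mset M - (s - 1)"
  have S: "s \<le> sum_mset M" using size_le_sum_mset[OF False] s by simp
  have exp: "sum_mset M + 2 - s = Suc e" "e \<ge> 1" using S s by (auto simp: e_def)
  have ne: "M \<noteq> {#}" using s by auto
  have "(\<Sum>k\<in>#M. q ^ k) \<le> real (s - 1) * q + q ^ e"
  proof -
    have "(\<Sum>k\<in>#M. q ^ k) = real (s - 1) * q + q ^ e"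
      if "M = replicate_mset (s - 1) 1 + {#e#}"
      by (subst that) simp
    then show ?thesis using sum_power_pos_multiset_le[OF q False ne] s by (auto simp: e_def)
  qed
  also have "\<dots> = real (s - 2) * q + q + q ^ e"
    using s by (simp add: of_nat_diff algebra_simps)
  \<comment> \<open>Entries \<open>1\<close> and \<open>e\<close> are exchanged for \<open>0\<close>
    and \<open>e + 1\<close>; the gain is \<open>(1 - q) * (1 - q ^ e)\<close>.\<close>
  also have "\<dots> < 1 + real (s - 2) * q + q ^ Suc e"
  proof -
    have "0 < (1 - q) * (1 - q ^ e)"
      using q exp by (intro mult_pos_pos) (auto simp: power_less_one_iff)
    then show ?thesis by (simp add: algebra_simps)
  qed
  finally show ?thesis using exp by simp
qed

text \<open>After factoring out \<open>q ^ (l + 1)\<close>, the bound for the multiset applies.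
  Strictness comes from the multiset when \<open>l = 0\<close> and from \<open>q ^ l < 1\<close>
  otherwise.\<close>

lemma theta_sum_less_max:
  fixes q :: real
  assumes q: "0 < q" "q < 1" and c: "count M 0 \<le> 1" and s: "size M = s" "s \<ge> 2"
    and n: "sum_mset M + l + 2 = n"
    and ne: "\<not> (M = add_mset 0 (replicate_mset (s - 2) 1 + {#n - s#}) \<and> l = 0)"
  shows "(\<Sum>k\<in>#M. q ^ (k + l + 1)) < q + real (s - 2) * q ^ 2 + q ^ (n - s + 1)"
proof -
  define d where "d = sum_mset M + 2 - s"
  let ?B = "1 + real (s - 2) * q + q ^ d"
  have le: "(\<Sum>k\<in>#M. q ^ k) \<le> ?B"
    and lt: "M \<noteq> add_mset 0 (replicate_mset (s - 2) 1 + {#d#}) \<Longrightarrow> (\<Sum>k\<in>#M. q ^ k) < ?B"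
  proof -
    have "(\<Sum>k\<in>#M. q ^ k) = ?B" if "M = add_mset 0 (replicate_mset (s - 2) 1 + {#d#})"
      by (subst that) simp
    then show "(\<Sum>k\<in>#M. q ^ k) \<le> ?B"
      "M \<noteq> add_mset 0 (replicate_mset (s - 2) 1 + {#d#}) \<Longrightarrow> (\<Sum>k\<in>#M. q ^ k) < ?B"
      using sum_power_multiset_le[OF q c s] by (auto simp: d_def)
  qed
  \<comment> \<open>At most one entry is zero; this keeps the truncated subtraction in
    \<open>d\<close> exact, so that \<open>n - s = d + l\<close>.\<close>
  have "s \<le> sum_mset M + 1"
  proof (cases "0 \<in># M")
    case True
    then obtain M' where M: "M = add_mset 0 M'" by (metis multi_member_split)
    then have "0 \<notin># M'" using c by (simp add: not_in_iff)
    then show ?thesis using size_le_sum_mset[of M'] M s by simp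
  next
    case False
    then show ?thesis using size_le_sum_mset[of M] s by simp
  qed
  then have ns: "n - s = d + l" using n by (simp add: d_def)
  have eq: "(\<Sum>k\<in>#M. q ^ (k + l + 1)) = q * (q ^ l * (\<Sum>k\<in>#M. q ^ k))"
    unfolding sum_mset_distrib_left
    by (simp add: image_mset.compositionality comp_def power_add algebra_simps)
  have "q ^ l * (\<Sum>k\<in>#M. q ^ k) < 1 + real (s - 2) * q + q ^ (d + l)"
  proof (cases "l = 0")
    case True
    then show ?thesis using lt ne ns by auto
  next
    case False
    have ql: "0 < q ^ l" "q ^ l < 1" using q False by (auto simp: power_less_one_iff)
    have "q ^ l * (\<Sum>k\<in>#M. q ^ k) \<le> q ^ l * ?B" using le ql by (intro mult_left_mono) auto
    \<comment> \<open>The longest path absorbs \<open>l\<close> exactly in the last term, while the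
      remaining terms shrink strictly.\<close>
    also have "\<dots> = q ^ l * (1 + real (s - 2) * q) + q ^ (d + l)"
      by (simp add: power_add algebra_simps)
    also have "q ^ l * (1 + real (s - 2) * q) < 1 * (1 + real (s - 2) * q)"
      using ql q by (intro mult_strict_right_mono) (auto intro: add_pos_nonneg)
    finally show ?thesis by simp
  qed
  then have "q * (q ^ l * (\<Sum>k\<in>#M. q ^ k)) < q * (1 + real (s - 2) * q + q ^ (d + l))"
    using q(1) by (rule mult_strict_left_mono)
  then show ?thesis unfolding eq ns by (simp add: algebra_simps power2_eq_square)
qed

text \<open>Since \<open>q < 1\<close>, upper bounds on exponents give lower bounds on the sum. With
  a zero entry, strictness comes from its own term, because \<open>l\<close> is maximal only when
  all other entries are 1. Without one, every exponent is at most \<open>n - s\<close>, one less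
  than the target allows for all but one term.\<close>

lemma theta_sum_greater_min:
  fixes q :: real
  assumes q: "0 < q" "q < 1" and c: "count M 0 \<le> 1" and s: "size M = s" "s \<ge> 2"
    and n: "sum_mset M + l + 2 = n"
    and ne: "\<not> (M = add_mset 0 (replicate_mset (s - 1) 1) \<and> l = n - s - 1)"
  shows "q ^ (n - s) + real (s - 1) * q ^ (n - s + 1) < (\<Sum>k\<in>#M. q ^ (k + l + 1))"
proof -
  \<comment> \<open>The entries other than \<open>k\<close> are at least 1 each, which limits what
    is left for \<open>k\<close>.\<close>
  have bound: "k + size M' \<le> Suc (sum_mset M')" if "k \<in># M'" "0 \<notin># M'" for k and M' :: "nat multiset"
  proof -
    from that obtain M'' where "M' = add_mset k M''" by (metis multi_member_split)
    with that show ?thesis using size_le_sum_mset[of M''] by simp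
  qed
  have lower: "real (size M') * q ^ e \<le> (\<Sum>k\<in>#M'. q ^ (k + l + 1))"
    if "\<And>k. k \<in># M' \<Longrightarrow> k + l + 1 \<le> e" for e and M' :: "nat multiset"
  proof -
    have "(\<Sum>k\<in>#M'. q ^ e) \<le> (\<Sum>k\<in>#M'. q ^ (k + l + 1))"
      using q that by (intro sum_mset_mono power_decreasing) auto
    then show ?thesis by simp
  qed
  show ?thesis
  proof (cases "0 \<in># M")
    case True
    then obtain M' where M: "M = add_mset 0 M'" by (metis multi_member_split)
    then have M': "0 \<notin># M'" using c by (simp add: not_in_iff)
    have size: "size M' = s - 1" and sum: "sum_mset M' + l + 2 = n" using M s n by auto
    have S: "s - 1 \<le> sum_mset M'" using size_le_sum_mset[OF M'] size by simp
    have "s - 1 \<noteq> sum_mset M'"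
    proof
      assume *: "s - 1 = sum_mset M'"
      then have "M' = replicate_mset (s - 1) 1"
        using eq_replicate_mset_of_sum_mset[OF M'] size by simp
      moreover have "l = n - s - 1" using * sum s by simp
      ultimately show False using ne M by simp
    qed
    then have "l + 1 < n - s" using S sum s by simp
    then have "q ^ (n - s) < q ^ (l + 1)" using q by (intro power_strict_decreasing) auto
    moreover have "real (size M') * q ^ (n - s + 1) \<le> (\<Sum>k\<in>#M'. q ^ (k + l + 1))"
    proof (rule lower)
      fix k assume "k \<in># M'"
      from bound[OF this M'] show "k + l + 1 \<le> n - s + 1" using size sum s by simp
    qed
    ultimately show ?thesis using M size by simp
  next
    case False
    have "real (size M) * q ^ (n - s) \<le> (\<Sum>k\<in>#M. q ^ (k + l + 1))"
    proof (rule lower)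
      fix k assume "k \<in># M"
      from bound[OF this False] show "k + l + 1 \<le> n - s" using n s by simp
    qed
    moreover have "real (s - 1) * q ^ (n - s + 1) < real (s - 1) * q ^ (n - s)"
      using q s by (intro mult_strict_left_mono power_strict_decreasing) auto
    ultimately show ?thesis using s by (simp add: of_nat_diff algebra_simps)
  qed
qed

section \<open>Isomorphism classes and the extremal digraphs\<close>

lemma digraph_iso_refl:
  assumes "wf_digraph G"
  shows "digraph_iso G G"
proof -
  let ?h = "\<lparr>iso_verts = id, iso_arcs = id, iso_head = head G, iso_tail = tail G\<rparr>"
  have "pre_digraph.digraph_isomorphism G ?h"
    using assms by (simp add: pre_digraph.digraph_isomorphism_def)
  moreover have "G = app_iso ?h G" by (simp add: app_iso_def)
  ultimately show ?thesis unfolding digraph_iso_def by blast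
qed

lemma card_verts_iso_theta:
  assumes "digraph_iso G (with_proj (theta ks l))" "ks \<noteq> []"
  shows "card (verts G) = sum_list ks + l + 2"
proof -
  from assms(1) obtain f where "pre_digraph.digraph_isomorphism G f"
    "with_proj (theta ks l) = app_iso f G" by (auto simp: digraph_iso_def)
  then have "card (verts G) = card (verts (with_proj (theta ks l)))"
    by (simp add: card_image pre_digraph.digraph_isomorphism_inj_on_verts)
  then show ?thesis using card_verts_theta[OF assms(2)] by simp
qed

theorem theorem2p6:
  fixes \<alpha> :: real and s n :: nat
  defines "Gmax \<equiv> with_proj (theta (0 # replicate (s - 2) 1 @ [n - s]) 0)"
      and "Gmin \<equiv> with_proj (theta (0 # replicate (s - 1) 1) (n - s - 1))"
  assumes "0 \<le> \<alpha>" and "\<alpha> < 1" and "s \<ge> 2" and "n \<ge> s + 1"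
  shows "is_theta_digraph s Gmax \<and> card (verts Gmax) = n
    \<and> (\<forall>G :: ('a, 'b) pre_digraph. is_theta_digraph s G \<and> card (verts G) = n \<longrightarrow>
         lambda_alpha \<alpha> G \<le> lambda_alpha \<alpha> Gmax \<and>
         (lambda_alpha \<alpha> G = lambda_alpha \<alpha> Gmax \<longleftrightarrow> digraph_iso G Gmax))
    \<and> is_theta_digraph s Gmin \<and> card (verts Gmin) = n
    \<and> (\<forall>G :: ('a, 'b) pre_digraph. is_theta_digraph s G \<and> card (verts G) = n \<longrightarrow>
         lambda_alpha \<alpha> Gmin \<le> lambda_alpha \<alpha> G \<and>
         (lambda_alpha \<alpha> G = lambda_alpha \<alpha> Gmin \<longleftrightarrow> digraph_iso G Gmin))"
proof -
  note \<alpha> = \<open>0 \<le> \<alpha>\<close> \<open>\<alpha> < 1\<close> and s = \<open>s \<ge> 2\<close> and n = \<open>n \<ge> s + 1\<close>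
  define kmax where "kmax = 0 # replicate (s - 2) 1 @ [n - s]"
  define kmin where "kmin = 0 # replicate (s - 1) (1::nat)"
  let ?lmin = "n - s - 1"
  have Gmax: "Gmax = with_proj (theta kmax 0)" and Gmin: "Gmin = with_proj (theta kmin ?lmin)"
    by (simp_all add: Gmax_def Gmin_def kmax_def kmin_def)
  have iso_self: "digraph_iso (with_proj (theta ks l)) (with_proj (theta ks l))" for ks l
  proof -
    interpret pair_digraph "theta ks l" by (rule pair_digraph_theta)
    show ?thesis by (rule digraph_iso_refl) (rule wf_digraph_axioms)
  qed
  have count_replicate: "count_list (replicate m (1::nat)) 0 = 0" for m
    by (induction m) auto
  have max: "length kmax = s" "count_list kmax 0 \<le> 1" "mset kmax = add_mset 0 (replicate_mset (s - 2) 1 + {#n - s#})"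
    "sum_list kmax + 0 + 2 = n"
    using s n by (auto simp: kmax_def count_list_append count_replicate sum_list_replicate)
  have min: "length kmin = s" "count_list kmin 0 \<le> 1" "mset kmin = add_mset 0 (replicate_mset (s - 1) 1)"
    "sum_list kmin + ?lmin + 2 = n"
    using s n by (auto simp: kmin_def count_replicate sum_list_replicate)
  have max_sum: "(\<Sum>k\<leftarrow>kmax. q ^ (k + 0 + 1)) = q + real (s - 2) * q ^ 2 + q ^ (n - s + 1)" for q :: real
    by (simp add: kmax_def sum_list_replicate power2_eq_square)
  have min_sum: "(\<Sum>k\<leftarrow>kmin. q ^ (k + ?lmin + 1)) = q ^ (n - s) + real (s - 1) * q ^ (n - s + 1)" for q :: real
  proof -
    obtain m where "n = s + 1 + m" using n le_Suc_ex by blast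
    then show ?thesis by (simp add: kmin_def sum_list_replicate)
  qed
  have sum_mset: "(\<Sum>k\<leftarrow>ks. q ^ (k + l + 1)) = (\<Sum>k\<in>#mset ks. q ^ (k + l + 1))" for ks l and q :: real
    by (simp add: sum_mset_sum_list[symmetric])
  have ne: "kmax \<noteq> []" "kmin \<noteq> []" by (simp_all add: kmax_def kmin_def)
  have theta: "is_theta_digraph s Gmax" "is_theta_digraph s Gmin"
    unfolding is_theta_digraph_def Gmax Gmin using max min iso_self by blast+
  have card: "card (verts Gmax) = n" "card (verts Gmin) = n"
    unfolding Gmax Gmin using card_verts_theta ne max(4) min(4) by auto
  \<comment> \<open>Isomorphic or strictly worse: together with invariance under isomorphism
    (\<open>eq\<close> and \<open>eq'\<close>), this yields both the inequalities and the equality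
    cases.\<close>
  have cases: "(digraph_iso G Gmax \<or> lambda_alpha \<alpha> G < lambda_alpha \<alpha> Gmax) \<and>
      (digraph_iso G Gmin \<or> lambda_alpha \<alpha> Gmin < lambda_alpha \<alpha> G)"
    if "is_theta_digraph s G" "card (verts G) = n" for G :: "('a, 'b) pre_digraph"
  proof -
    from that(1) obtain ks l where ks: "length ks = s" "count_list ks 0 \<le> 1"
      and iso: "digraph_iso G (with_proj (theta ks l))"
      unfolding is_theta_digraph_def by blast
    have "ks \<noteq> []" using ks s by auto
    then have sum: "sum_mset (mset ks) + l + 2 = n"
      using card_verts_iso_theta[OF iso] that(2) by (simp add: sum_mset_sum_list)
    have M: "count (mset ks) 0 \<le> 1" "size (mset ks) = s"
      using ks by (simp_all add: count_mset)
    have "digraph_iso G Gmax \<or> lambda_alpha \<alpha> G < lambda_alpha \<alpha> Gmax"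
    \<comment> \<open>The parameters matter only up to the order of the paths, so agreement of
      multisets already gives an isomorphism.\<close>
    proof (cases "mset ks = mset kmax \<and> l = 0")
      case True
      then show ?thesis
        using digraph_iso_trans[OF iso] digraph_iso_theta_permute unfolding Gmax by blast
    next
      case False
      have "lambda_alpha \<alpha> G < lambda_alpha \<alpha> Gmax"
      proof (rule lambda_alpha_theta_less[OF iso])
        show "digraph_iso Gmax (with_proj (theta kmax 0))" unfolding Gmax by (rule iso_self)
        show "(\<Sum>k\<leftarrow>ks. q ^ (k + l + 1)) < (\<Sum>k\<leftarrow>kmax. q ^ (k + 0 + 1))" if "0 < q" "q < 1" for q :: real
          unfolding max_sum unfolding sum_mset
          using theta_sum_less_max[OF that M s sum] False max(3) by simp
      qed (use ks max s \<alpha> in auto)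
      then show ?thesis ..
    qed
    moreover have "digraph_iso G Gmin \<or> lambda_alpha \<alpha> Gmin < lambda_alpha \<alpha> G"
    proof (cases "mset ks = mset kmin \<and> l = ?lmin")
      case True
      then show ?thesis
        using digraph_iso_trans[OF iso] digraph_iso_theta_permute unfolding Gmin by blast
    next
      case False
      have "lambda_alpha \<alpha> Gmin < lambda_alpha \<alpha> G"
      proof (rule lambda_alpha_theta_less[OF _ iso])
        show "digraph_iso Gmin (with_proj (theta kmin ?lmin))" unfolding Gmin by (rule iso_self)
        show "(\<Sum>k\<leftarrow>kmin. q ^ (k + ?lmin + 1)) < (\<Sum>k\<leftarrow>ks. q ^ (k + l + 1))" if "0 < q" "q < 1" for q :: real
          unfolding min_sum unfolding sum_mset
          using theta_sum_greater_min[OF that M s sum] False min(3) by simp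
      qed (use ks min s \<alpha> in auto)
      then show ?thesis ..
    qed
    ultimately show ?thesis ..
  qed
  have eq: "lambda_alpha \<alpha> G = lambda_alpha \<alpha> Gmax" if "digraph_iso G Gmax" for G :: "('a, 'b) pre_digraph"
    using lambda_alpha_theta_eq[of G kmax 0 Gmax] that max iso_self s \<alpha> unfolding Gmax by blast
  have eq': "lambda_alpha \<alpha> G = lambda_alpha \<alpha> Gmin" if "digraph_iso G Gmin" for G :: "('a, 'b) pre_digraph"
    using lambda_alpha_theta_eq[of G kmin ?lmin Gmin] that min iso_self s \<alpha> unfolding Gmin by blast
  show ?thesis
    using theta card cases eq eq' by (metis less_irrefl less_imp_le order_refl)
qed

end
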